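(* Let $\mathbb{A}$ be a symmetric strict monoidal category with braiding $\sigma$, and let $\mathbf{H}\,\mathcal{C}(\mathbb{A})$ be the strict monoidal category of horizontal cells of its free cornering. For all objects $A,B$ of $\mathbb{A}$ there is a morphism $d^\circ_\bullet:A^\circ\otimes B^\bullet\to B^\bullet\otimes A^\circ$ of $\mathbf{H}\,\mathcal{C}(\mathbb{A})$, given by the vertical composite, from top to bottom, of the cells $r^\circ_A\vert r^\bullet_B$, $\ulcorner\sigma_{A,B}\urcorner$ and $s^\bullet_B\vert s^\circ_A$. However, there need not be a morphism in the other direction, and $d^\circ_\bullet$ is not in general invertible: there exist a symmetric strict monoidal category $\mathbb{A}$ and objects $A,B$ of $\mathbb{A}$ for which there is no morphism $B^\bullet\otimes A^\circ\to A^\circ\otimes B^\bullet$ in $\mathbf{H}\,\mathcal{C}(\mathbb{A})$ (so that $d^\circ_\bullet$ is not invertible). In particular, $\mathbf{H}\,\mathcal{C}(\mathbb{A})$ is monoidal but need not be symmetric.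
   Context: Single-object double categories. A single-object double category $\mathbb{D}$ consists of a monoid $(\mathbb{D}_H,\otimes,I)$ of horizontal edges, a monoid $(\mathbb{D}_V,\otimes,I)$ of vertical edges, and cells $\alpha$, each with a top and a bottom boundary in $\mathbb{D}_H$ and a left and a right boundary in $\mathbb{D}_V$. If the right boundary of $\alpha$ equals the left boundary of $\beta$ there is a horizontal composite $\alpha\vert\beta$ (top/bottom boundaries are multiplied in the order $\alpha,\beta$; left boundary that of $\alpha$, right boundary that of $\beta$). If the bottom boundary of $\alpha$ equals the top boundary of $\beta$ there is a vertical composite $\frac{\alpha}{\beta}$ (left/right boundaries multiplied in the order $\alpha,\beta$; top that of $\alpha$, bottom that of $\beta$). Both compositions are associative and unital, with identity cells $1_A$ for $A\in\mathbb{D}_H$ (top $=$ bottom $=A$, left $=$ right $=I$; identities for vertical composition) and $1_X$ for $X\in\mathbb{D}_V$ (left $=$ right $=X$, top $=$ bottom $=I$; identities for horizontal composition), with $1_A\vert 1_B=1_{A\otimes B}$, $\frac{1_X}{1_Y}=1_{X\otimes Y}$, the two identity cells on $I$ coincide, and the interchange law $\frac{\alpha}{\beta}\big\vert\frac{\gamma}{\delta}=\frac{\alpha\vert\gamma}{\beta\vert\delta}$ holds. Horizontal cells. $\mathbf{H}\mathbb{D}$ is the strict monoidal category with object set $\mathbb{D}_V$, whose morphisms $X\to Y$ are cells with left boundary $X$, right boundary $Y$ and top and bottom boundary $I$; composition is horizontal composition, and the tensor product is vertical composition, $h\otimes k=\frac{h}{k}$. Free cornering. For a symmetric strict monoidal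 category $\mathbb{A}$ (with object set $\mathbb{A}_0$ and braiding $\sigma_{A,B}:A\otimes B\to B\otimes A$), $\mathcal{C}(\mathbb{A})$ is the free single-object double category determined by: horizontal edge monoid $(\mathbb{A}_0,\otimes,I)$; vertical edge monoid the free monoid $\mathbb{A}^{\circ\bullet}=(\mathbb{A}_0\times\{\circ,\bullet\})^*$, with generators written $A^\circ$, $A^\bullet$, product written $\otimes$ and unit $I$; generating cells, for each $A\in\mathbb{A}_0$, the corners (boundaries not mentioned are $I$) - $s^\circ_A$: top $A$, right $A^\circ$; $\quad r^\circ_A$: left $A^\circ$, bottom $A$; - $s^\bullet_A$: top $A$, left $A^\bullet$; $\quad r^\bullet_A$: right $A^\bullet$, bottom $A$; and, for each morphism $f:A\to B$ of $\mathbb{A}$, a cell $\ulcorner f\urcorner$ with top $A$, bottom $B$; subject to the yanking equations $s^\circ_A\vert r^\circ_A=1_A$, $\frac{r^\circ_A}{s^\circ_A}=1_{A^\circ}$, $r^\bullet_A\vert s^\bullet_A=1_A$, $\frac{r^\bullet_A}{s^\bullet_A}=1_{A^\bullet}$, and the equations $\frac{\ulcorner f\urcorner}{\ulcorner g\urcorner}=\ulcorner f;g\urcorner$ (for composable $f,g$; $f;g$ is "first $f$ then $g$"), $\ulcorner 1_A\urcorner=1_A$, $\ulcorner f\urcorner\vert\ulcorner g\urcorner=\ulcorner f\otimes g\urcorner$. *)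

theory Defs
  imports "HOL-Algebra.Group"
begin

section \<open>Strict monoidal categories\<close>

text \<open>\<open>seq\<close> is composition in diagrammatic order: \<open>seq C f g\<close> is "first \<open>f\<close>, then \<open>g\<close>".\<close>

record ('o, 'm) monoidal_cat =
  obs :: "'o monoid"
  arrs :: "'m set"
  src :: "'m \<Rightarrow> 'o"
  tgt :: "'m \<Rightarrow> 'o"
  ident :: "'o \<Rightarrow> 'm"
  seq :: "'m \<Rightarrow> 'm \<Rightarrow> 'm"
  tensor :: "'m \<Rightarrow> 'm \<Rightarrow> 'm"

definition homset :: "('o, 'm) monoidal_cat \<Rightarrow> 'o \<Rightarrow> 'o \<Rightarrow> 'm set" where
  "homset C a b = {f \<in> arrs C. src C f = a \<and> tgt C f = b}"

definition invertible_arr :: "('o, 'm) monoidal_cat \<Rightarrow> 'm \<Rightarrow> bool" where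
  "invertible_arr C f \<longleftrightarrow> f \<in> arrs C \<and>
     (\<exists>g \<in> homset C (tgt C f) (src C f).
        seq C f g = ident C (src C f) \<and> seq C g f = ident C (tgt C f))"

locale strict_monoidal_category =
  fixes C :: "('o, 'm) monoidal_cat"
  assumes obs_monoid: "monoid (obs C)"
    and src_closed: "f \<in> arrs C \<Longrightarrow> src C f \<in> carrier (obs C)"
    and tgt_closed: "f \<in> arrs C \<Longrightarrow> tgt C f \<in> carrier (obs C)"
    and ident_type: "a \<in> carrier (obs C) \<Longrightarrow> ident C a \<in> homset C a a"
    and seq_type: "\<lbrakk>f \<in> homset C a b; g \<in> homset C b c\<rbrakk> \<Longrightarrow> seq C f g \<in> homset C a c"
    and ident_seq: "f \<in> homset C a b \<Longrightarrow> seq C (ident C a) f = f"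
    and seq_ident: "f \<in> homset C a b \<Longrightarrow> seq C f (ident C b) = f"
    and seq_assoc: "\<lbrakk>f \<in> homset C a b; g \<in> homset C b c; h \<in> homset C c d\<rbrakk>
        \<Longrightarrow> seq C (seq C f g) h = seq C f (seq C g h)"
    and tensor_type: "\<lbrakk>f \<in> homset C a b; g \<in> homset C c d\<rbrakk>
        \<Longrightarrow> tensor C f g \<in> homset C (a \<otimes>\<^bsub>obs C\<^esub> c) (b \<otimes>\<^bsub>obs C\<^esub> d)"
    and tensor_ident: "\<lbrakk>a \<in> carrier (obs C); b \<in> carrier (obs C)\<rbrakk>
        \<Longrightarrow> tensor C (ident C a) (ident C b) = ident C (a \<otimes>\<^bsub>obs C\<^esub> b)"
    and tensor_seq: "\<lbrakk>f \<in> homset C a b; g \<in> homset C b c;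
          f' \<in> homset C a' b'; g' \<in> homset C b' c'\<rbrakk>
        \<Longrightarrow> tensor C (seq C f g) (seq C f' g') = seq C (tensor C f f') (tensor C g g')"
    and tensor_assoc: "\<lbrakk>f \<in> arrs C; g \<in> arrs C; h \<in> arrs C\<rbrakk>
        \<Longrightarrow> tensor C (tensor C f g) h = tensor C f (tensor C g h)"
    and unit_tensor: "f \<in> arrs C \<Longrightarrow> tensor C (ident C \<one>\<^bsub>obs C\<^esub>) f = f"
    and tensor_unit: "f \<in> arrs C \<Longrightarrow> tensor C f (ident C \<one>\<^bsub>obs C\<^esub>) = f"

text \<open>The second hexagon and the unit coherence of the braiding follow from the axioms below.\<close>

locale symmetric_strict_monoidal_category = strict_monoidal_category C
  for C :: "('o, 'm) monoidal_cat" +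
  fixes \<sigma> :: "'o \<Rightarrow> 'o \<Rightarrow> 'm"
  assumes braid_type: "\<lbrakk>a \<in> carrier (obs C); b \<in> carrier (obs C)\<rbrakk>
        \<Longrightarrow> \<sigma> a b \<in> homset C (a \<otimes>\<^bsub>obs C\<^esub> b) (b \<otimes>\<^bsub>obs C\<^esub> a)"
    and braid_natural: "\<lbrakk>f \<in> homset C a b; g \<in> homset C c d\<rbrakk>
        \<Longrightarrow> seq C (tensor C f g) (\<sigma> b d) = seq C (\<sigma> a c) (tensor C g f)"
    and braid_involutive: "\<lbrakk>a \<in> carrier (obs C); b \<in> carrier (obs C)\<rbrakk>
        \<Longrightarrow> seq C (\<sigma> a b) (\<sigma> b a) = ident C (a \<otimes>\<^bsub>obs C\<^esub> b)"
    and braid_hexagon: "\<lbrakk>a \<in> carrier (obs C); b \<in> carrier (obs C); c \<in> carrier (obs C)\<rbrakk>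
        \<Longrightarrow> \<sigma> a (b \<otimes>\<^bsub>obs C\<^esub> c)
          = seq C (tensor C (\<sigma> a b) (ident C c)) (tensor C (ident C b) (\<sigma> a c))"


section \<open>Single-object double categories\<close>

record ('h, 'v, 'c) double_cat =
  hedges :: "'h monoid"
  vedges :: "'v monoid"
  cells :: "'c set"
  ctop :: "'c \<Rightarrow> 'h"
  cbot :: "'c \<Rightarrow> 'h"
  cleft :: "'c \<Rightarrow> 'v"
  cright :: "'c \<Rightarrow> 'v"
  hcomp :: "'c \<Rightarrow> 'c \<Rightarrow> 'c"
  vcomp :: "'c \<Rightarrow> 'c \<Rightarrow> 'c"  \<comment> \<open>first argument on top\<close>
  hedge_id :: "'h \<Rightarrow> 'c"
  vedge_id :: "'v \<Rightarrow> 'c"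

definition bounded_cells :: "('h, 'v, 'c) double_cat \<Rightarrow> 'h \<Rightarrow> 'h \<Rightarrow> 'v \<Rightarrow> 'v \<Rightarrow> 'c set" where
  "bounded_cells D t b l r =
     {\<alpha> \<in> cells D. ctop D \<alpha> = t \<and> cbot D \<alpha> = b \<and> cleft D \<alpha> = l \<and> cright D \<alpha> = r}"

locale single_object_double_category =
  fixes D :: "('h, 'v, 'c) double_cat"
  assumes hedges_monoid: "monoid (hedges D)"
    and vedges_monoid: "monoid (vedges D)"
    and boundary_closed: "\<alpha> \<in> cells D \<Longrightarrow>
          ctop D \<alpha> \<in> carrier (hedges D) \<and> cbot D \<alpha> \<in> carrier (hedges D) \<and>
          cleft D \<alpha> \<in> carrier (vedges D) \<and> cright D \<alpha> \<in> carrier (vedges D)"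
    and hcomp_type: "\<lbrakk>\<alpha> \<in> bounded_cells D t b l m; \<beta> \<in> bounded_cells D t' b' m r\<rbrakk>
        \<Longrightarrow> hcomp D \<alpha> \<beta> \<in> bounded_cells D (t \<otimes>\<^bsub>hedges D\<^esub> t') (b \<otimes>\<^bsub>hedges D\<^esub> b') l r"
    and vcomp_type: "\<lbrakk>\<alpha> \<in> bounded_cells D t k l r; \<beta> \<in> bounded_cells D k b l' r'\<rbrakk>
        \<Longrightarrow> vcomp D \<alpha> \<beta> \<in> bounded_cells D t b (l \<otimes>\<^bsub>vedges D\<^esub> l') (r \<otimes>\<^bsub>vedges D\<^esub> r')"
    and hedge_id_type: "a \<in> carrier (hedges D)
        \<Longrightarrow> hedge_id D a \<in> bounded_cells D a a \<one>\<^bsub>vedges D\<^esub> \<one>\<^bsub>vedges D\<^esub>"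
    and vedge_id_type: "x \<in> carrier (vedges D)
        \<Longrightarrow> vedge_id D x \<in> bounded_cells D \<one>\<^bsub>hedges D\<^esub> \<one>\<^bsub>hedges D\<^esub> x x"
    and hcomp_assoc: "\<lbrakk>\<alpha> \<in> cells D; \<beta> \<in> cells D; \<gamma> \<in> cells D;
          cright D \<alpha> = cleft D \<beta>; cright D \<beta> = cleft D \<gamma>\<rbrakk>
        \<Longrightarrow> hcomp D (hcomp D \<alpha> \<beta>) \<gamma> = hcomp D \<alpha> (hcomp D \<beta> \<gamma>)"
    and vcomp_assoc: "\<lbrakk>\<alpha> \<in> cells D; \<beta> \<in> cells D; \<gamma> \<in> cells D;
          cbot D \<alpha> = ctop D \<beta>; cbot D \<beta> = ctop D \<gamma>\<rbrakk>
        \<Longrightarrow> vcomp D (vcomp D \<alpha> \<beta>) \<gamma> = vcomp D \<alpha> (vcomp D \<beta> \<gamma>)"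
    and hcomp_unit: "\<alpha> \<in> cells D \<Longrightarrow>
          hcomp D (vedge_id D (cleft D \<alpha>)) \<alpha> = \<alpha> \<and> hcomp D \<alpha> (vedge_id D (cright D \<alpha>)) = \<alpha>"
    and vcomp_unit: "\<alpha> \<in> cells D \<Longrightarrow>
          vcomp D (hedge_id D (ctop D \<alpha>)) \<alpha> = \<alpha> \<and> vcomp D \<alpha> (hedge_id D (cbot D \<alpha>)) = \<alpha>"
    and hedge_id_mult: "\<lbrakk>a \<in> carrier (hedges D); b \<in> carrier (hedges D)\<rbrakk>
        \<Longrightarrow> hcomp D (hedge_id D a) (hedge_id D b) = hedge_id D (a \<otimes>\<^bsub>hedges D\<^esub> b)"
    and vedge_id_mult: "\<lbrakk>x \<in> carrier (vedges D); y \<in> carrier (vedges D)\<rbrakk>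
        \<Longrightarrow> vcomp D (vedge_id D x) (vedge_id D y) = vedge_id D (x \<otimes>\<^bsub>vedges D\<^esub> y)"
    and id_unit: "hedge_id D \<one>\<^bsub>hedges D\<^esub> = vedge_id D \<one>\<^bsub>vedges D\<^esub>"
    and interchange: "\<lbrakk>\<alpha> \<in> cells D; \<beta> \<in> cells D; \<gamma> \<in> cells D; \<delta> \<in> cells D;
          cbot D \<alpha> = ctop D \<beta>; cbot D \<gamma> = ctop D \<delta>;
          cright D \<alpha> = cleft D \<gamma>; cright D \<beta> = cleft D \<delta>\<rbrakk>
        \<Longrightarrow> hcomp D (vcomp D \<alpha> \<beta>) (vcomp D \<gamma> \<delta>) = vcomp D (hcomp D \<alpha> \<gamma>) (hcomp D \<beta> \<delta>)"

definition horizontal_cells :: "('h, 'v, 'c) double_cat \<Rightarrow> ('v, 'c) monoidal_cat" where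
  "horizontal_cells D =
     \<lparr> obs = vedges D,
       arrs = {\<alpha> \<in> cells D. ctop D \<alpha> = \<one>\<^bsub>hedges D\<^esub> \<and> cbot D \<alpha> = \<one>\<^bsub>hedges D\<^esub>},
       src = cleft D,
       tgt = cright D,
       ident = vedge_id D,
       seq = hcomp D,
       tensor = vcomp D \<rparr>"


section \<open>Free single-object double categories\<close>

text \<open>The single-object double category presented by edge monoids, generating cells and
  equations: well-formed formal composites, modulo the least congruence containing the
  equations and the axioms of single-object double categories.\<close>

record ('h, 'v, 'g) cell_signature =
  sig_h :: "'h monoid"
  sig_v :: "'v monoid"
  gens :: "'g set"
  gtop :: "'g \<Rightarrow> 'h"
  gbot :: "'g \<Rightarrow> 'h"
  gleft :: "'g \<Rightarrow> 'v"
  gright :: "'g \<Rightarrow> 'v"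

datatype ('h, 'v, 'g) cell_term =
    Gen 'g
  | HId 'h
  | VId 'v
  | HComp "('h, 'v, 'g) cell_term" "('h, 'v, 'g) cell_term"
  | VComp "('h, 'v, 'g) cell_term" "('h, 'v, 'g) cell_term"

primrec tm_top :: "('h, 'v, 'g) cell_signature \<Rightarrow> ('h, 'v, 'g) cell_term \<Rightarrow> 'h" where
  "tm_top S (Gen g) = gtop S g"
| "tm_top S (HId a) = a"
| "tm_top S (VId x) = \<one>\<^bsub>sig_h S\<^esub>"
| "tm_top S (HComp s t) = tm_top S s \<otimes>\<^bsub>sig_h S\<^esub> tm_top S t"
| "tm_top S (VComp s t) = tm_top S s"

primrec tm_bot :: "('h, 'v, 'g) cell_signature \<Rightarrow> ('h, 'v, 'g) cell_term \<Rightarrow> 'h" where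
  "tm_bot S (Gen g) = gbot S g"
| "tm_bot S (HId a) = a"
| "tm_bot S (VId x) = \<one>\<^bsub>sig_h S\<^esub>"
| "tm_bot S (HComp s t) = tm_bot S s \<otimes>\<^bsub>sig_h S\<^esub> tm_bot S t"
| "tm_bot S (VComp s t) = tm_bot S t"

primrec tm_left :: "('h, 'v, 'g) cell_signature \<Rightarrow> ('h, 'v, 'g) cell_term \<Rightarrow> 'v" where
  "tm_left S (Gen g) = gleft S g"
| "tm_left S (HId a) = \<one>\<^bsub>sig_v S\<^esub>"
| "tm_left S (VId x) = x"
| "tm_left S (HComp s t) = tm_left S s"
| "tm_left S (VComp s t) = tm_left S s \<otimes>\<^bsub>sig_v S\<^esub> tm_left S t"

primrec tm_right :: "('h, 'v, 'g) cell_signature \<Rightarrow> ('h, 'v, 'g) cell_term \<Rightarrow> 'v" where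
  "tm_right S (Gen g) = gright S g"
| "tm_right S (HId a) = \<one>\<^bsub>sig_v S\<^esub>"
| "tm_right S (VId x) = x"
| "tm_right S (HComp s t) = tm_right S t"
| "tm_right S (VComp s t) = tm_right S s \<otimes>\<^bsub>sig_v S\<^esub> tm_right S t"

primrec well_formed :: "('h, 'v, 'g) cell_signature \<Rightarrow> ('h, 'v, 'g) cell_term \<Rightarrow> bool" where
  "well_formed S (Gen g) \<longleftrightarrow> g \<in> gens S"
| "well_formed S (HId a) \<longleftrightarrow> a \<in> carrier (sig_h S)"
| "well_formed S (VId x) \<longleftrightarrow> x \<in> carrier (sig_v S)"
| "well_formed S (HComp s t) \<longleftrightarrow> well_formed S s \<and> well_formed S t \<and> tm_right S s = tm_left S t"
| "well_formed S (VComp s t) \<longleftrightarrow> well_formed S s \<and> well_formed S t \<and> tm_bot S s = tm_top S t"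

inductive cell_eq ::
  "('h, 'v, 'g) cell_signature \<Rightarrow> (('h, 'v, 'g) cell_term \<times> ('h, 'v, 'g) cell_term) set \<Rightarrow>
   ('h, 'v, 'g) cell_term \<Rightarrow> ('h, 'v, 'g) cell_term \<Rightarrow> bool"
  for S E where
  eq_base: "\<lbrakk>(s, t) \<in> E; well_formed S s; well_formed S t\<rbrakk> \<Longrightarrow> cell_eq S E s t"
| eq_refl: "well_formed S t \<Longrightarrow> cell_eq S E t t"
| eq_sym: "cell_eq S E s t \<Longrightarrow> cell_eq S E t s"
| eq_trans: "\<lbrakk>cell_eq S E s t; cell_eq S E t u\<rbrakk> \<Longrightarrow> cell_eq S E s u"
| eq_hcong: "\<lbrakk>cell_eq S E s s'; cell_eq S E t t'; well_formed S (HComp s t)\<rbrakk>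
    \<Longrightarrow> cell_eq S E (HComp s t) (HComp s' t')"
| eq_vcong: "\<lbrakk>cell_eq S E s s'; cell_eq S E t t'; well_formed S (VComp s t)\<rbrakk>
    \<Longrightarrow> cell_eq S E (VComp s t) (VComp s' t')"
| eq_hassoc: "well_formed S (HComp (HComp s t) u)
    \<Longrightarrow> cell_eq S E (HComp (HComp s t) u) (HComp s (HComp t u))"
| eq_vassoc: "well_formed S (VComp (VComp s t) u)
    \<Longrightarrow> cell_eq S E (VComp (VComp s t) u) (VComp s (VComp t u))"
| eq_hunit_left: "well_formed S t \<Longrightarrow> cell_eq S E (HComp (VId (tm_left S t)) t) t"
| eq_hunit_right: "well_formed S t \<Longrightarrow> cell_eq S E (HComp t (VId (tm_right S t))) t"
| eq_vunit_top: "well_formed S t \<Longrightarrow> cell_eq S E (VComp (HId (tm_top S t)) t) t"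
| eq_vunit_bot: "well_formed S t \<Longrightarrow> cell_eq S E (VComp t (HId (tm_bot S t))) t"
| eq_hid_mult: "\<lbrakk>a \<in> carrier (sig_h S); b \<in> carrier (sig_h S)\<rbrakk>
    \<Longrightarrow> cell_eq S E (HComp (HId a) (HId b)) (HId (a \<otimes>\<^bsub>sig_h S\<^esub> b))"
| eq_vid_mult: "\<lbrakk>x \<in> carrier (sig_v S); y \<in> carrier (sig_v S)\<rbrakk>
    \<Longrightarrow> cell_eq S E (VComp (VId x) (VId y)) (VId (x \<otimes>\<^bsub>sig_v S\<^esub> y))"
| eq_id_unit: "cell_eq S E (HId \<one>\<^bsub>sig_h S\<^esub>) (VId \<one>\<^bsub>sig_v S\<^esub>)"
| eq_interchange: "\<lbrakk>well_formed S (VComp s t); well_formed S (VComp u v);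
      tm_right S s = tm_left S u; tm_right S t = tm_left S v\<rbrakk>
    \<Longrightarrow> cell_eq S E (HComp (VComp s t) (VComp u v)) (VComp (HComp s u) (HComp t v))"

definition cell_class ::
  "('h, 'v, 'g) cell_signature \<Rightarrow> (('h, 'v, 'g) cell_term \<times> ('h, 'v, 'g) cell_term) set \<Rightarrow>
   ('h, 'v, 'g) cell_term \<Rightarrow> ('h, 'v, 'g) cell_term set" where
  "cell_class S E t = {s. cell_eq S E t s}"

definition cell_rep :: "('h, 'v, 'g) cell_term set \<Rightarrow> ('h, 'v, 'g) cell_term" where
  "cell_rep c = (SOME t. t \<in> c)"

definition free_double_cat ::
  "('h, 'v, 'g) cell_signature \<Rightarrow> (('h, 'v, 'g) cell_term \<times> ('h, 'v, 'g) cell_term) set \<Rightarrow>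
   ('h, 'v, ('h, 'v, 'g) cell_term set) double_cat" where
  "free_double_cat S E =
     \<lparr> hedges = sig_h S,
       vedges = sig_v S,
       cells = cell_class S E ` {t. well_formed S t},
       ctop = (\<lambda>c. tm_top S (cell_rep c)),
       cbot = (\<lambda>c. tm_bot S (cell_rep c)),
       cleft = (\<lambda>c. tm_left S (cell_rep c)),
       cright = (\<lambda>c. tm_right S (cell_rep c)),
       hcomp = (\<lambda>c d. cell_class S E (HComp (cell_rep c) (cell_rep d))),
       vcomp = (\<lambda>c d. cell_class S E (VComp (cell_rep c) (cell_rep d))),
       hedge_id = (\<lambda>a. cell_class S E (HId a)),
       vedge_id = (\<lambda>x. cell_class S E (VId x)) \<rparr>"

locale cell_presentation =
  fixes S :: "('h, 'v, 'g) cell_signature"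
    and E :: "(('h, 'v, 'g) cell_term \<times> ('h, 'v, 'g) cell_term) set"
  assumes h_monoid: "monoid (sig_h S)"
    and v_monoid: "monoid (sig_v S)"
    and gen_boundary: "g \<in> gens S \<Longrightarrow>
          gtop S g \<in> carrier (sig_h S) \<and> gbot S g \<in> carrier (sig_h S) \<and>
          gleft S g \<in> carrier (sig_v S) \<and> gright S g \<in> carrier (sig_v S)"
    and equation_boundary: "(s, t) \<in> E \<Longrightarrow> well_formed S s \<and> well_formed S t \<and>
          tm_top S s = tm_top S t \<and> tm_bot S s = tm_bot S t \<and>
          tm_left S s = tm_left S t \<and> tm_right S s = tm_right S t"
begin

interpretation H: monoid "sig_h S" by (rule h_monoid)
interpretation V: monoid "sig_v S" by (rule v_monoid)

lemma tm_boundary: "well_formed S t \<Longrightarrow>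
    tm_top S t \<in> carrier (sig_h S) \<and> tm_bot S t \<in> carrier (sig_h S) \<and>
    tm_left S t \<in> carrier (sig_v S) \<and> tm_right S t \<in> carrier (sig_v S)"
  by (induction t) (auto simp: gen_boundary)

lemma cell_eq_boundary: "cell_eq S E s t \<Longrightarrow> well_formed S s \<and> well_formed S t \<and>
    tm_top S s = tm_top S t \<and> tm_bot S s = tm_bot S t \<and>
    tm_left S s = tm_left S t \<and> tm_right S s = tm_right S t"
  by (induction rule: cell_eq.induct)
    (use equation_boundary tm_boundary in
      \<open>auto simp: H.m_assoc V.m_assoc\<close>)

lemma cell_class_eq_iff:
  assumes "well_formed S s"
  shows "cell_class S E s = cell_class S E t \<longleftrightarrow> cell_eq S E s t"
proof
  assume "cell_class S E s = cell_class S E t"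
  then have "s \<in> cell_class S E t"
    using eq_refl[OF assms, of E] unfolding cell_class_def by auto
  then show "cell_eq S E s t"
    by (auto simp: cell_class_def intro: eq_sym)
next
  assume "cell_eq S E s t"
  then show "cell_class S E s = cell_class S E t"
    by (auto simp: cell_class_def intro: eq_sym eq_trans)
qed

lemma cell_rep_eq:
  assumes "well_formed S t"
  shows "cell_eq S E t (cell_rep (cell_class S E t))"
proof -
  have "t \<in> cell_class S E t"
    using eq_refl[OF assms] by (simp add: cell_class_def)
  then have "cell_rep (cell_class S E t) \<in> cell_class S E t"
    unfolding cell_rep_def by (rule someI)
  then show ?thesis by (simp add: cell_class_def)
qed

lemma cell_rep_class:
  assumes "well_formed S t"
  shows "well_formed S (cell_rep (cell_class S E t))"
    and "tm_top S (cell_rep (cell_class S E t)) = tm_top S t"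
    and "tm_bot S (cell_rep (cell_class S E t)) = tm_bot S t"
    and "tm_left S (cell_rep (cell_class S E t)) = tm_left S t"
    and "tm_right S (cell_rep (cell_class S E t)) = tm_right S t"
  using cell_eq_boundary[OF cell_rep_eq[OF assms]] by auto

lemma hcomp_class:
  assumes "well_formed S (HComp s t)"
  shows "cell_class S E (HComp (cell_rep (cell_class S E s)) (cell_rep (cell_class S E t)))
       = cell_class S E (HComp s t)"
proof -
  have "cell_eq S E (HComp s t)
          (HComp (cell_rep (cell_class S E s)) (cell_rep (cell_class S E t)))"
    using assms by (intro eq_hcong cell_rep_eq) auto
  then show ?thesis using cell_class_eq_iff[OF assms] by metis
qed

lemma vcomp_class:
  assumes "well_formed S (VComp s t)"
  shows "cell_class S E (VComp (cell_rep (cell_class S E s)) (cell_rep (cell_class S E t)))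
       = cell_class S E (VComp s t)"
proof -
  have "cell_eq S E (VComp s t)
          (VComp (cell_rep (cell_class S E s)) (cell_rep (cell_class S E t)))"
    using assms by (intro eq_vcong cell_rep_eq) auto
  then show ?thesis using cell_class_eq_iff[OF assms] by metis
qed

lemma cell_class_eqI: "cell_eq S E s t \<Longrightarrow> cell_class S E s = cell_class S E t"
  using cell_class_eq_iff cell_eq_boundary by blast

theorem free_double_cat_is_double_cat: "single_object_double_category (free_double_cat S E)"
proof (rule single_object_double_category.intro, goal_cases)
  case (8 \<alpha> \<beta> \<gamma>)
  then obtain s t u where tms: "well_formed S s" "well_formed S t" "well_formed S u"
    "\<alpha> = cell_class S E s" "\<beta> = cell_class S E t" "\<gamma> = cell_class S E u"
    by (auto simp: free_double_cat_def)
  then have "well_formed S (HComp (HComp s t) u)"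
    using 8 by (auto simp: free_double_cat_def cell_rep_class)
  from cell_class_eqI[OF eq_hassoc[OF this]] this show ?case
    by (simp add: tms free_double_cat_def hcomp_class)
next
  case (9 \<alpha> \<beta> \<gamma>)
  then obtain s t u where tms: "well_formed S s" "well_formed S t" "well_formed S u"
    "\<alpha> = cell_class S E s" "\<beta> = cell_class S E t" "\<gamma> = cell_class S E u"
    by (auto simp: free_double_cat_def)
  then have "well_formed S (VComp (VComp s t) u)"
    using 9 by (auto simp: free_double_cat_def cell_rep_class)
  from cell_class_eqI[OF eq_vassoc[OF this]] this show ?case
    by (simp add: tms free_double_cat_def vcomp_class)
next
  case (10 \<alpha>)
  then obtain s where s: "well_formed S s" "\<alpha> = cell_class S E s"
    by (auto simp: free_double_cat_def)
  then show ?case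
    using cell_class_eqI[OF eq_hunit_left[OF s(1)]] cell_class_eqI[OF eq_hunit_right[OF s(1)]]
    by (simp add: free_double_cat_def hcomp_class cell_rep_class tm_boundary)
next
  case (11 \<alpha>)
  then obtain s where s: "well_formed S s" "\<alpha> = cell_class S E s"
    by (auto simp: free_double_cat_def)
  then show ?case
    using cell_class_eqI[OF eq_vunit_top[OF s(1)]] cell_class_eqI[OF eq_vunit_bot[OF s(1)]]
    by (simp add: free_double_cat_def vcomp_class cell_rep_class tm_boundary)
next
  case (12 a b)
  then show ?case
    using cell_class_eqI[OF eq_hid_mult[of a S b E]] by (simp add: free_double_cat_def hcomp_class)
next
  case (13 x y)
  then show ?case
    using cell_class_eqI[OF eq_vid_mult[of x S y E]] by (simp add: free_double_cat_def vcomp_class)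
next
  case 14
  show ?case
    using cell_class_eqI[OF eq_id_unit[of S E]] by (simp add: free_double_cat_def)
next
  case (15 \<alpha> \<beta> \<gamma> \<delta>)
  then obtain s t u v where tms:
    "well_formed S s" "well_formed S t" "well_formed S u" "well_formed S v"
    "\<alpha> = cell_class S E s" "\<beta> = cell_class S E t" "\<gamma> = cell_class S E u" "\<delta> = cell_class S E v"
    by (auto simp: free_double_cat_def)
  then have "well_formed S (VComp s t)" "well_formed S (VComp u v)"
    "tm_right S s = tm_left S u" "tm_right S t = tm_left S v"
    using 15 by (auto simp: free_double_cat_def cell_rep_class)
  from cell_class_eqI[OF eq_interchange[OF this]] this show ?case
    by (simp add: tms free_double_cat_def hcomp_class vcomp_class)
qed (auto simp: free_double_cat_def bounded_cells_def h_monoid v_monoid cell_rep_class tm_boundary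
      hcomp_class vcomp_class)

end


section \<open>The free cornering\<close>

datatype polarity = Circ | Bullet

type_synonym 'o exchange = "('o \<times> polarity) list"

definition exchange_monoid :: "'o set \<Rightarrow> 'o exchange monoid" where
  "exchange_monoid X = \<lparr> carrier = lists (X \<times> UNIV), mult = (@), one = [] \<rparr>"

definition circ_edge :: "'o \<Rightarrow> 'o exchange" where
  "circ_edge a = [(a, Circ)]"

definition bullet_edge :: "'o \<Rightarrow> 'o exchange" where
  "bullet_edge a = [(a, Bullet)]"

datatype ('o, 'm) corner_gen =
    SCirc 'o | RCirc 'o | SBullet 'o | RBullet 'o | Embed 'm

primrec corner_top :: "('o, 'm) monoidal_cat \<Rightarrow> ('o, 'm) corner_gen \<Rightarrow> 'o" where
  "corner_top C (SCirc a) = a"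
| "corner_top C (RCirc a) = \<one>\<^bsub>obs C\<^esub>"
| "corner_top C (SBullet a) = a"
| "corner_top C (RBullet a) = \<one>\<^bsub>obs C\<^esub>"
| "corner_top C (Embed f) = src C f"

primrec corner_bot :: "('o, 'm) monoidal_cat \<Rightarrow> ('o, 'm) corner_gen \<Rightarrow> 'o" where
  "corner_bot C (SCirc a) = \<one>\<^bsub>obs C\<^esub>"
| "corner_bot C (RCirc a) = a"
| "corner_bot C (SBullet a) = \<one>\<^bsub>obs C\<^esub>"
| "corner_bot C (RBullet a) = a"
| "corner_bot C (Embed f) = tgt C f"

primrec corner_left :: "('o, 'm) corner_gen \<Rightarrow> 'o exchange" where
  "corner_left (SCirc a) = []"
| "corner_left (RCirc a) = circ_edge a"
| "corner_left (SBullet a) = bullet_edge a"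
| "corner_left (RBullet a) = []"
| "corner_left (Embed f) = []"

primrec corner_right :: "('o, 'm) corner_gen \<Rightarrow> 'o exchange" where
  "corner_right (SCirc a) = circ_edge a"
| "corner_right (RCirc a) = []"
| "corner_right (SBullet a) = []"
| "corner_right (RBullet a) = bullet_edge a"
| "corner_right (Embed f) = []"

definition corner_signature ::
  "('o, 'm) monoidal_cat \<Rightarrow> ('o, 'o exchange, ('o, 'm) corner_gen) cell_signature" where
  "corner_signature C =
     \<lparr> sig_h = obs C,
       sig_v = exchange_monoid (carrier (obs C)),
       gens = SCirc ` carrier (obs C) \<union> RCirc ` carrier (obs C) \<union>
              SBullet ` carrier (obs C) \<union> RBullet ` carrier (obs C) \<union> Embed ` arrs C,
       gtop = corner_top C,
       gbot = corner_bot C,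
       gleft = corner_left,
       gright = corner_right \<rparr>"

type_synonym ('o, 'm) corner_term = "('o, 'o exchange, ('o, 'm) corner_gen) cell_term"

inductive_set corner_equations ::
  "('o, 'm) monoidal_cat \<Rightarrow> (('o, 'm) corner_term \<times> ('o, 'm) corner_term) set"
  for C where
  yank_circ_h: "a \<in> carrier (obs C) \<Longrightarrow>
    (HComp (Gen (SCirc a)) (Gen (RCirc a)), HId a) \<in> corner_equations C"
| yank_circ_v: "a \<in> carrier (obs C) \<Longrightarrow>
    (VComp (Gen (RCirc a)) (Gen (SCirc a)), VId (circ_edge a)) \<in> corner_equations C"
| yank_bullet_h: "a \<in> carrier (obs C) \<Longrightarrow>
    (HComp (Gen (RBullet a)) (Gen (SBullet a)), HId a) \<in> corner_equations C"
| yank_bullet_v: "a \<in> carrier (obs C) \<Longrightarrow>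
    (VComp (Gen (RBullet a)) (Gen (SBullet a)), VId (bullet_edge a)) \<in> corner_equations C"
| embed_seq: "\<lbrakk>f \<in> arrs C; g \<in> arrs C; tgt C f = src C g\<rbrakk> \<Longrightarrow>
    (VComp (Gen (Embed f)) (Gen (Embed g)), Gen (Embed (seq C f g))) \<in> corner_equations C"
| embed_ident: "a \<in> carrier (obs C) \<Longrightarrow>
    (Gen (Embed (ident C a)), HId a) \<in> corner_equations C"
| embed_tensor: "\<lbrakk>f \<in> arrs C; g \<in> arrs C\<rbrakk> \<Longrightarrow>
    (HComp (Gen (Embed f)) (Gen (Embed g)), Gen (Embed (tensor C f g))) \<in> corner_equations C"

definition free_cornering ::
  "('o, 'm) monoidal_cat \<Rightarrow> ('o, 'o exchange, ('o, 'm) corner_term set) double_cat" where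
  "free_cornering C = free_double_cat (corner_signature C) (corner_equations C)"

definition corner_cell ::
  "('o, 'm) monoidal_cat \<Rightarrow> ('o, 'm) corner_gen \<Rightarrow> ('o, 'm) corner_term set" where
  "corner_cell C g = cell_class (corner_signature C) (corner_equations C) (Gen g)"

definition d_circ_bullet ::
  "('o, 'm) monoidal_cat \<Rightarrow> ('o \<Rightarrow> 'o \<Rightarrow> 'm) \<Rightarrow> 'o \<Rightarrow> 'o \<Rightarrow> ('o, 'm) corner_term set" where
  "d_circ_bullet C \<sigma> a b =
     (let hc = hcomp (free_cornering C); vc = vcomp (free_cornering C)
      in vc (vc (hc (corner_cell C (RCirc a)) (corner_cell C (RBullet b)))
                (corner_cell C (Embed (\<sigma> a b))))
            (hc (corner_cell C (SBullet b)) (corner_cell C (SCirc a))))"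

lemma free_cornering_is_double_cat:
  assumes "strict_monoidal_category C"
  shows "single_object_double_category (free_cornering C)"
proof -
  interpret strict_monoidal_category C by (rule assms)
  interpret O: monoid "obs C" by (rule obs_monoid)
  have V: "monoid (exchange_monoid (carrier (obs C)))"
    by unfold_locales (auto simp: exchange_monoid_def)
  have "cell_presentation (corner_signature C) (corner_equations C)"
  proof (rule cell_presentation.intro, goal_cases)
    case (4 s t)
    then show ?case
    proof cases
      case (embed_seq f g)
      then show ?thesis
        using seq_type[of f "src C f" "src C g" g "tgt C g"]
        by (auto simp: corner_signature_def homset_def exchange_monoid_def)
    next
      case (embed_ident a)
      then show ?thesis
        using ident_type[of a]
        by (auto simp: corner_signature_def homset_def exchange_monoid_def)
    next
      case (embed_tensor f g)
      then show ?thesis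
        using tensor_type[of f "src C f" "tgt C f" g "src C g" "tgt C g"]
        by (auto simp: corner_signature_def homset_def exchange_monoid_def)
    qed (auto simp: corner_signature_def exchange_monoid_def circ_edge_def bullet_edge_def)
  qed (use obs_monoid V src_closed tgt_closed in
      \<open>auto simp: corner_signature_def exchange_monoid_def circ_edge_def bullet_edge_def\<close>)
  then show ?thesis
    unfolding free_cornering_def by (rule cell_presentation.free_double_cat_is_double_cat)
qed

lemma horizontal_cells_strict_monoidal:
  assumes "single_object_double_category D"
  shows "strict_monoidal_category (horizontal_cells D)"
proof -
  interpret single_object_double_category D by (rule assms)
  interpret H: monoid "hedges D" by (rule hedges_monoid)
  show ?thesis
  proof (rule strict_monoidal_category.intro, goal_cases)
    case (5 f a b g c)
    then show ?case
      using hcomp_type[of f "\<one>\<^bsub>hedges D\<^esub>" "\<one>\<^bsub>hedges D\<^esub>" a b g "\<one>\<^bsub>hedges D\<^esub>" "\<one>\<^bsub>hedges D\<^esub>" c]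
      by (auto simp: horizontal_cells_def homset_def bounded_cells_def)
  next
    case (9 f a b g c d)
    then show ?case
      using vcomp_type[of f "\<one>\<^bsub>hedges D\<^esub>" "\<one>\<^bsub>hedges D\<^esub>" a b g "\<one>\<^bsub>hedges D\<^esub>" c d]
      by (auto simp: horizontal_cells_def homset_def bounded_cells_def)
  next
    case (4 a)
    then show ?case
      using vedge_id_type[of a] by (auto simp: horizontal_cells_def homset_def bounded_cells_def)
  next
    case (13 f)
    then show ?case
      using vcomp_unit[of f] id_unit by (auto simp: horizontal_cells_def)
  next
    case (14 f)
    then show ?case
      using vcomp_unit[of f] id_unit by (auto simp: horizontal_cells_def)
  qed (use vedges_monoid boundary_closed hcomp_unit hcomp_assoc vcomp_assoc vedge_id_mult interchange[symmetric] interchange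
       in \<open>auto simp: horizontal_cells_def homset_def\<close>)
qed

end

(* In the discrete symmetric monoidal category on (nat, +), a cell moves resources: a circ letter
   on the left boundary (or bullet on the right) is an input, the other two kinds are outputs.
   Weigh an exchange by counting circ letters positively and bullet letters negatively.  Then for
   every cell with top t, bottom b, left L and right R we have t + weight L = b + weight R
   (conservation) and, writing low for the minimal weight of a prefix, low R <= t + low L
   (nothing can be sent before it is available).  A cell from bullet,circ to circ,bullet with
   trivial top and bottom would have low L = -1 and low R = 0. *)
theory Submission
  imports Defs
begin

text \<open>Puts the facts of \<open>cell_presentation\<close> at disposal for the cornering, above
  all \<open>cell_rep_class\<close>: the boundaries of a class can be read off any term representing
  it.\<close>

lemma free_cornering_presentation:
  assumes "strict_monoidal_category C"
  shows "cell_presentation (corner_signature C) (corner_equations C)"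
proof -
  interpret strict_monoidal_category C by (rule assms)
  have V: "monoid (exchange_monoid (carrier (obs C)))"
    by unfold_locales (auto simp: exchange_monoid_def)
  show ?thesis
  proof (rule cell_presentation.intro, goal_cases)
    case (4 s t)
    then show ?case
    proof cases
      case (embed_seq f g)
      then show ?thesis
        using seq_type[of f "src C f" "src C g" g "tgt C g"]
        by (auto simp: corner_signature_def homset_def exchange_monoid_def)
    next
      case (embed_ident a)
      then show ?thesis
        using ident_type[of a]
        by (auto simp: corner_signature_def homset_def exchange_monoid_def)
    next
      case (embed_tensor f g)
      then show ?thesis
        using tensor_type[of f "src C f" "tgt C f" g "src C g" "tgt C g"]
        by (auto simp: corner_signature_def homset_def exchange_monoid_def)
    qed (use obs_monoid in \<open>auto simp: corner_signature_def exchange_monoid_def circ_edge_def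
        bullet_edge_def monoid.l_one monoid.r_one\<close>)
  qed (use obs_monoid V src_closed tgt_closed in
      \<open>auto simp: corner_signature_def exchange_monoid_def circ_edge_def bullet_edge_def\<close>)
qed

lemma corner_cell_bounded:
  assumes "strict_monoidal_category C" and "g \<in> gens (corner_signature C)"
  shows "corner_cell C g \<in> bounded_cells (free_cornering C)
           (corner_top C g) (corner_bot C g) (corner_left g) (corner_right g)"
proof -
  interpret cell_presentation "corner_signature C" "corner_equations C"
    by (rule free_cornering_presentation[OF assms(1)])
  show ?thesis
    using cell_rep_class[of "Gen g"] assms(2)
    by (auto simp: bounded_cells_def corner_cell_def free_cornering_def free_double_cat_def
        corner_signature_def)
qed

text \<open>Reduces nonexistence of cells to nonexistence of terms. Since equivalent terms share
  their boundaries, an invariant that mentions only boundaries can be proved by induction on terms,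
  with no check against \<open>cell_eq\<close>.\<close>

lemma bounded_free_cornering_cellE:
  assumes "strict_monoidal_category C" and "c \<in> bounded_cells (free_cornering C) t b l r"
  obtains s where "well_formed (corner_signature C) s"
    "tm_top (corner_signature C) s = t" "tm_bot (corner_signature C) s = b"
    "tm_left (corner_signature C) s = l" "tm_right (corner_signature C) s = r"
proof -
  interpret cell_presentation "corner_signature C" "corner_equations C"
    by (rule free_cornering_presentation[OF assms(1)])
  show thesis
    using assms(2) that
    by (auto simp: bounded_cells_def free_cornering_def free_double_cat_def cell_rep_class)
qed

lemma homset_horizontal_cells:
  "homset (horizontal_cells D) x y = bounded_cells D \<one>\<^bsub>hedges D\<^esub> \<one>\<^bsub>hedges D\<^esub> x y"
  by (auto simp: homset_def horizontal_cells_def bounded_cells_def)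

lemma hedges_free_cornering [simp]: "hedges (free_cornering C) = obs C"
  by (simp add: free_cornering_def free_double_cat_def corner_signature_def)

lemma vedges_free_cornering [simp]:
  "vedges (free_cornering C) = exchange_monoid (carrier (obs C))"
  by (simp add: free_cornering_def free_double_cat_def corner_signature_def)

lemma obs_horizontal_free_cornering [simp]:
  "obs (horizontal_cells (free_cornering C)) = exchange_monoid (carrier (obs C))"
  by (simp add: horizontal_cells_def)

lemma exchange_monoid_simps [simp]:
  "carrier (exchange_monoid X) = lists (X \<times> UNIV)"
  "x \<otimes>\<^bsub>exchange_monoid X\<^esub> y = x @ y"
  "\<one>\<^bsub>exchange_monoid X\<^esub> = []"
  by (simp_all add: exchange_monoid_def)

text \<open>The top row receives \<open>a\<close> from the left and \<open>b\<close> from the right,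
  the braid crosses them, and the bottom row sends \<open>b\<close> to the left and \<open>a\<close>
  to the right. The braid has empty sides, so it adds no letters.\<close>

lemma d_circ_bullet_homset:
  assumes "symmetric_strict_monoidal_category C \<sigma>"
    and a: "a \<in> carrier (obs C)" and b: "b \<in> carrier (obs C)"
  shows "d_circ_bullet C \<sigma> a b \<in> homset (horizontal_cells (free_cornering C))
           (circ_edge a @ bullet_edge b) (bullet_edge b @ circ_edge a)"
proof -
  interpret symmetric_strict_monoidal_category C \<sigma> by (rule assms(1))
  interpret monoid "obs C" by (rule obs_monoid)
  interpret D: single_object_double_category "free_cornering C"
    by (rule free_cornering_is_double_cat) unfold_locales
  note gen = corner_cell_bounded[OF strict_monoidal_category_axioms]
  have rr: "hcomp (free_cornering C) (corner_cell C (RCirc a)) (corner_cell C (RBullet b))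
      \<in> bounded_cells (free_cornering C) \<one>\<^bsub>obs C\<^esub> (a \<otimes>\<^bsub>obs C\<^esub> b) (circ_edge a) (bullet_edge b)"
    using D.hcomp_type[OF gen[of "RCirc a", simplified] gen[of "RBullet b", simplified]] a b
    by (simp add: corner_signature_def)
  have ss: "hcomp (free_cornering C) (corner_cell C (SBullet b)) (corner_cell C (SCirc a))
      \<in> bounded_cells (free_cornering C) (b \<otimes>\<^bsub>obs C\<^esub> a) \<one>\<^bsub>obs C\<^esub> (bullet_edge b) (circ_edge a)"
    using D.hcomp_type[OF gen[of "SBullet b", simplified] gen[of "SCirc a", simplified]] a b
    by (simp add: corner_signature_def)
  have braid: "corner_cell C (Embed (\<sigma> a b))
      \<in> bounded_cells (free_cornering C) (a \<otimes>\<^bsub>obs C\<^esub> b) (b \<otimes>\<^bsub>obs C\<^esub> a) [] []"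
    using gen[of "Embed (\<sigma> a b)"] braid_type[OF a b]
    by (auto simp: corner_signature_def homset_def)
  show ?thesis
    using D.vcomp_type[OF D.vcomp_type[OF rr braid] ss]
    by (simp add: d_circ_bullet_def homset_horizontal_cells Let_def)
qed

text \<open>The arrow \<open>n\<close> is the identity of the object \<open>n\<close>. Composable
  arrows are therefore equal, and returning the first one is composition.\<close>

definition nat_cat :: "(nat, nat) monoidal_cat" where
  "nat_cat = \<lparr> obs = \<lparr> carrier = UNIV, mult = (+), one = 0 \<rparr>, arrs = UNIV,
     src = id, tgt = id, ident = id, seq = (\<lambda>f g. f), tensor = (+) \<rparr>"

text \<open>As addition commutes, \<open>a + b\<close> and \<open>b + a\<close> are the same object,
  and its identity arrow serves as the braiding.\<close>

lemma nat_cat_symmetric: "symmetric_strict_monoidal_category nat_cat (+)"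
  by unfold_locales (auto simp: nat_cat_def homset_def)

fun letter_weight :: "nat \<times> polarity \<Rightarrow> int" where
  "letter_weight (n, Circ) = int n"
| "letter_weight (n, Bullet) = - int n"

definition weight :: "nat exchange \<Rightarrow> int" where
  "weight x = sum_list (map letter_weight x)"

lemma weight_simps [simp]:
  "weight [] = 0"
  "weight (p # x) = letter_weight p + weight x"
  "weight (x @ y) = weight x + weight y"
  by (simp_all add: weight_def)

text \<open>The \<open>0\<close> in the minimum accounts for the empty prefix.\<close>

primrec low :: "nat exchange \<Rightarrow> int" where
  "low [] = 0"
| "low (p # x) = min 0 (letter_weight p + low x)"

lemma low_nonpos: "low x \<le> 0"
  by (cases x) auto

text \<open>A prefix of \<open>x @ y\<close> is a prefix of \<open>x\<close> or all of
  \<open>x\<close> followed by a prefix of \<open>y\<close>.\<close>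

lemma low_append: "low (x @ y) = min (low x) (weight x + low y)"
  using low_nonpos by (induction x) auto

text \<open>The two halves are proved together because the bound on \<open>low\<close> for a
  vertical composite uses conservation in its upper cell.\<close>

lemma nat_cornering_term_invariant:
  fixes S defines "S \<equiv> corner_signature nat_cat"
  assumes "well_formed S s"
  shows "int (tm_top S s) + weight (tm_left S s) = int (tm_bot S s) + weight (tm_right S s) \<and>
         low (tm_right S s) \<le> int (tm_top S s) + low (tm_left S s)"
  using assms(2)
proof (induction s)
  case (Gen g)
  then show ?case
    by (auto simp: S_def corner_signature_def nat_cat_def circ_edge_def bullet_edge_def)
\<comment> \<open>Horizontally, the two bounds chain through the shared side. Vertically, with
  \<open>k\<close> the shared edge, \<open>weight R1 + low R2\<close> is at most
  \<open>weight R1 + k + low L2\<close>, and conservation turns \<open>weight R1 + k\<close> into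
  \<open>t + weight L1\<close>.\<close>
qed (auto simp: S_def corner_signature_def nat_cat_def low_append)

lemma no_bullet_circ_swap:
  "homset (horizontal_cells (free_cornering nat_cat))
     (bullet_edge 1 @ circ_edge 1) (circ_edge 1 @ bullet_edge 1) = {}"
proof -
  interpret symmetric_strict_monoidal_category nat_cat "(+)" by (rule nat_cat_symmetric)
  have False if c: "c \<in> bounded_cells (free_cornering nat_cat) 0 0
      (bullet_edge 1 @ circ_edge 1) (circ_edge 1 @ bullet_edge 1)" for c
  proof -
    obtain s where s: "well_formed (corner_signature nat_cat) s"
      "tm_top (corner_signature nat_cat) s = 0"
      "tm_left (corner_signature nat_cat) s = bullet_edge 1 @ circ_edge 1"
      "tm_right (corner_signature nat_cat) s = circ_edge 1 @ bullet_edge 1"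
      using bounded_free_cornering_cellE[OF strict_monoidal_category_axioms c] by blast
    \<comment> \<open>Both sides have weight 0, so conservation holds here; the contradiction is the
      bound on \<open>low\<close>, which reads 0 \<le> -1.\<close>
    show False
      using nat_cornering_term_invariant[OF s(1)] s(2-4)
      by (simp add: bullet_edge_def circ_edge_def)
  qed
  then show ?thesis
    by (auto simp: homset_horizontal_cells nat_cat_def)
qed

theorem mainTheorem6:
  shows
    "(\<forall>(\<A> :: ('o, 'm) monoidal_cat) \<sigma>. symmetric_strict_monoidal_category \<A> \<sigma> \<longrightarrow>
        strict_monoidal_category (horizontal_cells (free_cornering \<A>)) \<and>
        (\<forall>A \<in> carrier (obs \<A>). \<forall>B \<in> carrier (obs \<A>).
           d_circ_bullet \<A> \<sigma> A B \<in> homset (horizontal_cells (free_cornering \<A>))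
             (circ_edge A \<otimes>\<^bsub>obs (horizontal_cells (free_cornering \<A>))\<^esub> bullet_edge B)
             (bullet_edge B \<otimes>\<^bsub>obs (horizontal_cells (free_cornering \<A>))\<^esub> circ_edge A)))
     \<and>
     (\<exists>(\<A> :: (nat, nat) monoidal_cat) \<sigma>. symmetric_strict_monoidal_category \<A> \<sigma> \<and>
        (\<exists>A \<in> carrier (obs \<A>). \<exists>B \<in> carrier (obs \<A>).
           homset (horizontal_cells (free_cornering \<A>))
             (bullet_edge B \<otimes>\<^bsub>obs (horizontal_cells (free_cornering \<A>))\<^esub> circ_edge A)
             (circ_edge A \<otimes>\<^bsub>obs (horizontal_cells (free_cornering \<A>))\<^esub> bullet_edge B) = {} \<and>
           \<not> invertible_arr (horizontal_cells (free_cornering \<A>)) (d_circ_bullet \<A> \<sigma> A B)) \<and>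
        \<not> (\<exists>\<tau>. symmetric_strict_monoidal_category (horizontal_cells (free_cornering \<A>)) \<tau>))"
proof (intro conjI allI impI ballI, goal_cases)
  case (1 \<A> \<sigma>)
  then interpret symmetric_strict_monoidal_category \<A> \<sigma> .
  show ?case
    by (intro horizontal_cells_strict_monoidal free_cornering_is_double_cat) unfold_locales
next
  case (2 \<A> \<sigma> A B)
  then show ?case
    by (simp add: d_circ_bullet_homset)
next
  case 3
  let ?H = "horizontal_cells (free_cornering nat_cat)"
  \<comment> \<open>Both witnesses are the object 1. The object 0 would give no contradiction, since
    its letters weigh 0.\<close>
  have one: "1 \<in> carrier (obs nat_cat)"
    by (simp add: nat_cat_def)
  have "\<not> invertible_arr ?H (d_circ_bullet nat_cat (+) 1 1)"
  proof -
    have "src ?H (d_circ_bullet nat_cat (+) 1 1) = circ_edge 1 @ bullet_edge 1"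
      "tgt ?H (d_circ_bullet nat_cat (+) 1 1) = bullet_edge 1 @ circ_edge 1"
      using d_circ_bullet_homset[OF nat_cat_symmetric one one] unfolding homset_def by blast+
    then show ?thesis
      unfolding invertible_arr_def using no_bullet_circ_swap by (metis empty_iff)
  qed
  \<comment> \<open>The component of any braiding at these two edges would lie in the empty
    homset.\<close>
  moreover have False if "symmetric_strict_monoidal_category ?H \<tau>" for \<tau>
    using symmetric_strict_monoidal_category.braid_type[OF that, of "bullet_edge 1" "circ_edge 1"]
      no_bullet_circ_swap one
    by (simp add: bullet_edge_def circ_edge_def)
  ultimately show ?case
    using nat_cat_symmetric one no_bullet_circ_swap
    by (intro exI[of _ nat_cat] exI[of _ "(+)"] conjI bexI[of _ 1]) auto
qed

end
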